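(* Let $n\ge 1$ and $\pi\in\mathfrak{S}_n$. Then $\mathfrak{S}(H_R(\pi))$ equals the lower Bruhat interval $[\mathrm{id},\pi]=\{\sigma\in\mathfrak{S}_n:\sigma\le\pi\}$ in $\mathfrak{S}_n$ if and only if $\pi$ avoids the patterns $4231$, $35142$, $42513$ and $351624$.
   Context: Permutations $\pi\in\mathfrak{S}_n$ are identified with rook configurations (sets of cells, no two in the same row or column) on an $n\times n$ grid: there is a rook in cell $(i,j)$ (row $i$, column $j$) iff $\pi(i)=j$. A zero-one $n\times n$ matrix $A$ is identified with the set of its one-entries; $A$ covers a rook configuration if every rook lies on a one-entry of $A$. For such $A$, $\mathfrak{S}(A)$ is the set of $\pi\in\mathfrak{S}_n$ with $A_{i,\pi(i)}=1$ for all $i$. A zero-one matrix $\lambda$ is a right-aligned (resp. left-aligned) Ferrers matrix if every one-entry has one-entries directly to its right (resp. left) and directly above it, whenever those entries exist. A right-aligned (resp. left-aligned) skew Ferrers matrix is a difference $\lambda-\mu$ where $\lambda,\mu$ are right-aligned (resp. left-aligned) Ferrers matrices of the same size with $\mu\le\lambda$ entrywise. The right hull $H_R(\pi)$ is the smallest right-aligned skew Ferrers matrix covering $\pi$. The Bruhat order on $\mathfrak{S}_n$ is the usual (strong) Bruhat order; equivalently $\sigma\le\rho$ iff $|\{a\le i:\sigma(a)\ge j\}|\le|\{a\le i:\rho(a)\ge j\}|$ for all $i,j\in[n]$. Pattern avoidance is in the usual sense. *)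

theory Defs
  imports "HOL-Combinatorics.Permutations"
begin

text \<open>
  A permutation of size \<open>n\<close> is a function \<open>\<pi>\<close> with \<open>\<pi> permutes {1..n}\<close>.  A zero-one
  \<open>n \<times> n\<close> matrix is identified with the set of its one-entries, a subset of
  \<open>{1..n} \<times> {1..n}\<close>; the cell \<open>(i, j)\<close> lies in row \<open>i\<close> (counted from the top) and column \<open>j\<close>
  (counted from the left), and the entrywise order is set inclusion.
\<close>

definition right_ferrers :: "nat \<Rightarrow> (nat \<times> nat) set \<Rightarrow> bool" where
  "right_ferrers n L \<longleftrightarrow>
     L \<subseteq> {1..n} \<times> {1..n} \<and>
     (\<forall>i j. (i, j) \<in> L \<longrightarrow>
        (j < n \<longrightarrow> (i, j + 1) \<in> L) \<and> (1 < i \<longrightarrow> (i - 1, j) \<in> L))"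

definition right_skew_ferrers :: "nat \<Rightarrow> (nat \<times> nat) set \<Rightarrow> bool" where
  "right_skew_ferrers n A \<longleftrightarrow>
     (\<exists>L M. right_ferrers n L \<and> right_ferrers n M \<and> M \<subseteq> L \<and> A = L - M)"

definition covers :: "nat \<Rightarrow> (nat \<times> nat) set \<Rightarrow> (nat \<Rightarrow> nat) \<Rightarrow> bool" where
  "covers n A \<pi> \<longleftrightarrow> (\<forall>i\<in>{1..n}. (i, \<pi> i) \<in> A)"

definition right_hull :: "nat \<Rightarrow> (nat \<Rightarrow> nat) \<Rightarrow> (nat \<times> nat) set" where
  "right_hull n \<pi> = (LEAST A. right_skew_ferrers n A \<and> covers n A \<pi>)"

definition rook_perms :: "nat \<Rightarrow> (nat \<times> nat) set \<Rightarrow> (nat \<Rightarrow> nat) set" where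
  "rook_perms n A = {\<sigma>. \<sigma> permutes {1..n} \<and> covers n A \<sigma>}"

definition inv_number :: "nat \<Rightarrow> (nat \<Rightarrow> nat) \<Rightarrow> nat" where
  "inv_number n \<sigma> = card {(i, j). i \<in> {1..n} \<and> j \<in> {1..n} \<and> i < j \<and> \<sigma> j < \<sigma> i}"

text \<open>
  The strong Bruhat order is the reflexive transitive closure of multiplication by a
  (not necessarily adjacent) transposition that increases the length, the length of a
  permutation being its number of inversions.
\<close>

definition bruhat_step :: "nat \<Rightarrow> (nat \<Rightarrow> nat) \<Rightarrow> (nat \<Rightarrow> nat) \<Rightarrow> bool" where
  "bruhat_step n \<sigma> \<rho> \<longleftrightarrow>
     (\<exists>i\<in>{1..n}. \<exists>j\<in>{1..n}. i \<noteq> j \<and> \<rho> = \<sigma> \<circ> transpose i j) \<and>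
     inv_number n \<sigma> < inv_number n \<rho>"

definition bruhat_le :: "nat \<Rightarrow> (nat \<Rightarrow> nat) \<Rightarrow> (nat \<Rightarrow> nat) \<Rightarrow> bool" where
  "bruhat_le n = (bruhat_step n)\<^sup>*\<^sup>*"

definition lower_bruhat_interval :: "nat \<Rightarrow> (nat \<Rightarrow> nat) \<Rightarrow> (nat \<Rightarrow> nat) set" where
  "lower_bruhat_interval n \<pi> = {\<sigma>. \<sigma> permutes {1..n} \<and> bruhat_le n \<sigma> \<pi>}"

text \<open>
  The pattern is given by its one-line notation.  An occurrence of it is an increasing
  sequence \<open>f 0 < f 1 < \<dots>\<close> of positions at which the values of \<open>\<pi>\<close> are in the same
  relative order as the letters of the pattern.
\<close>

definition contains_pattern :: "nat \<Rightarrow> (nat \<Rightarrow> nat) \<Rightarrow> nat list \<Rightarrow> bool" where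
  "contains_pattern n \<pi> p \<longleftrightarrow>
     (\<exists>f. strict_mono_on {..<length p} f \<and> f ` {..<length p} \<subseteq> {1..n} \<and>
          (\<forall>a<length p. \<forall>b<length p. \<pi> (f a) < \<pi> (f b) \<longleftrightarrow> p ! a < p ! b))"

abbreviation avoids_pattern :: "nat \<Rightarrow> (nat \<Rightarrow> nat) \<Rightarrow> nat list \<Rightarrow> bool" where
  "avoids_pattern n \<pi> p \<equiv> \<not> contains_pattern n \<pi> p"

text \<open>
  Right-aligned skew Ferrers matrices are closed under intersection, so the smallest one
  covering a given permutation exists.
\<close>

lemma right_skew_ferrers_Inter:
  assumes "F \<noteq> {}" and "\<And>A. A \<in> F \<Longrightarrow> right_skew_ferrers n A"
  shows "right_skew_ferrers n (\<Inter>F)"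
proof -
  from assms(2) have "\<forall>A\<in>F. \<exists>L M. right_ferrers n L \<and> right_ferrers n M \<and> A = L - M"
    unfolding right_skew_ferrers_def by blast
  then obtain L M
    where L: "\<And>A. A \<in> F \<Longrightarrow> right_ferrers n (L A)"
      and M: "\<And>A. A \<in> F \<Longrightarrow> right_ferrers n (M A)"
      and eq: "\<And>A. A \<in> F \<Longrightarrow> A = L A - M A"
    by metis
  define L' where "L' = (\<Inter>A\<in>F. L A)"
  define M' where "M' = L' \<inter> (\<Union>A\<in>F. M A)"
  have "right_ferrers n L'"
    using L assms(1) unfolding right_ferrers_def L'_def by blast
  moreover from this have "right_ferrers n M'"
    using M unfolding right_ferrers_def M'_def by blast
  moreover have "\<Inter>F = L' - M'"
    using eq assms(1) unfolding L'_def M'_def by blast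
  ultimately show ?thesis
    unfolding right_skew_ferrers_def M'_def by blast
qed

lemma right_hull_least:
  assumes "\<pi> permutes {1..n}"
  shows "right_skew_ferrers n (right_hull n \<pi>)" and "covers n (right_hull n \<pi>) \<pi>"
    and "right_skew_ferrers n A \<Longrightarrow> covers n A \<pi> \<Longrightarrow> right_hull n \<pi> \<subseteq> A"
proof -
  define F where "F = {A. right_skew_ferrers n A \<and> covers n A \<pi>}"
  have ferr: "right_ferrers n ({1..n} \<times> {1..n})" "right_ferrers n {}"
    unfolding right_ferrers_def by auto
  have "right_skew_ferrers n ({1..n} \<times> {1..n})"
    unfolding right_skew_ferrers_def
    by (rule exI[of _ "{1..n} \<times> {1..n}"], rule exI[of _ "{}"]) (use ferr in simp)
  moreover have "covers n ({1..n} \<times> {1..n}) \<pi>"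
    using permutes_in_image[OF assms] unfolding covers_def by blast
  ultimately have "F \<noteq> {}" unfolding F_def by blast
  then have I: "right_skew_ferrers n (\<Inter>F)" "covers n (\<Inter>F) \<pi>"
    using right_skew_ferrers_Inter[of F n] unfolding F_def covers_def by blast+
  have hull: "right_hull n \<pi> = \<Inter>F"
    unfolding right_hull_def by (rule Least_equality) (use I in \<open>auto simp: F_def\<close>)
  from I hull show "right_skew_ferrers n (right_hull n \<pi>)" "covers n (right_hull n \<pi>) \<pi>"
    by simp_all
  show "right_hull n \<pi> \<subseteq> A" if "right_skew_ferrers n A" "covers n A \<pi>"
    using that unfolding hull F_def by blast
qed

end

theory Submission
  imports Defs
begin

text \<open>
  A cell lies in the right hull of \<open>\<pi>\<close> iff some rook of \<open>\<pi>\<close> is weakly north-east of it and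
  some rook weakly south-west, whereas \<open>\<sigma> \<le> \<pi>\<close> iff no north-east quadrant contains more rooks
  of \<open>\<sigma>\<close> than of \<open>\<pi>\<close>; so the interval is always contained in the set of rook placements.
  An occurrence of 4231, 35142, 42513 or 351624 in \<open>\<pi>\<close> can be rearranged inside the hull to
  4321, 15432, 43215 or 154326, which puts an additional rook into some north-east quadrant.

  Conversely, let \<open>\<sigma>\<close> be a placement in the hull with too many rooks in the quadrant with
  corner \<open>(i, j)\<close>. Deleting a row or column whose \<open>\<pi>\<close>-rook lies in this quadrant keeps \<open>\<sigma>\<close>
  in excess, so we may assume that the \<open>\<pi>\<close>-rook of row \<open>i\<close> lies in the north-west and that of
  column \<open>j\<close> in the south-east. The excess in the opposite, south-west quadrant is the same, and
  that quadrant can be shrunk in the same way without losing the two rooks just found. The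
  rooks that bound the two quadrants, together with one rook in each, form one of the four
  patterns.
\<close>

section \<open>Opposite quadrants of a cut of the grid\<close>

definition ne_count :: "nat \<Rightarrow> (nat \<Rightarrow> nat) \<Rightarrow> nat \<Rightarrow> nat \<Rightarrow> nat" where
  "ne_count n \<sigma> i j = card {a \<in> {1..n}. a \<le> i \<and> j \<le> \<sigma> a}"

text \<open>Strict where \<open>ne_count\<close> is weak: the two regions are opposite quadrants of
  one cut, between rows \<open>i\<close> and \<open>i + 1\<close> and between columns
  \<open>j - 1\<close> and \<open>j\<close>.\<close>

definition sw_count :: "nat \<Rightarrow> (nat \<Rightarrow> nat) \<Rightarrow> nat \<Rightarrow> nat \<Rightarrow> nat" where
  "sw_count n \<sigma> i j = card {a \<in> {1..n}. i < a \<and> \<sigma> a < j}"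

lemma permutes_in_interval:
  assumes "\<sigma> permutes {1..n}" "a \<in> {1..n}" shows "\<sigma> a \<in> {1..n}"
  using permutes_in_image[OF assms(1)] assms(2) by blast

lemma permutes_neq:
  assumes "\<sigma> permutes {1..n}" "a \<noteq> b" shows "\<sigma> a \<noteq> \<sigma> b"
  using permutes_inj[OF assms(1)] assms(2) by (meson injD)

lemma permutes_preimage:
  assumes "\<sigma> permutes {1..n}" "j \<in> {1..n}" obtains a where "a \<in> {1..n}" "\<sigma> a = j"
proof -
  have "j \<in> \<sigma> ` {1..n}" using assms(2) by (simp only: permutes_image[OF assms(1)])
  then show ?thesis using that by (elim imageE) simp
qed

subsection \<open>The right hull\<close>

lemma right_ferrers_closed:
  assumes "right_ferrers n L" "(i, j) \<in> L" "1 \<le> i'" "i' \<le> i" "j \<le> j'" "j' \<le> n"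
  shows "(i', j') \<in> L"
proof -
  have up: "(i', j) \<in> L"
    using assms(4,3)
  proof (induction rule: inc_induct)
    case base
    show ?case by fact
  next
    case (step k)
    then have "(Suc k, j) \<in> L" by simp
    with assms(1) step.prems show ?case
      unfolding right_ferrers_def by fastforce
  qed
  show ?thesis
    using assms(5,6)
  proof (induction rule: dec_induct)
    case base
    show ?case by (fact up)
  next
    case (step k)
    then have "(i', k) \<in> L" by simp
    with assms(1) step.prems show ?case
      unfolding right_ferrers_def by fastforce
  qed
qed

text \<open>The cells with a rook weakly south-west form a Ferrers matrix \<open>L\<close>, and
  those among them without a rook weakly north-east a smaller one, so \<open>?H\<close> is skew
  Ferrers. Conversely, in a presentation \<open>L - M\<close> of the hull, closure of
  \<open>L\<close> reaches the cell from its south-western rook, while a cell in \<open>M\<close>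
  would drag the north-eastern rook into \<open>M\<close>.\<close>

lemma right_hull_eq:
  assumes p: "\<pi> permutes {1..n}"
  shows "right_hull n \<pi> = {(i, j). i \<in> {1..n} \<and> j \<in> {1..n} \<and>
    (\<exists>a\<in>{i..n}. \<pi> a \<le> j) \<and> (\<exists>a\<in>{1..i}. j \<le> \<pi> a)}" (is "_ = ?H")
proof
  define L where "L = {(i, j). i \<in> {1..n} \<and> j \<in> {1..n} \<and> (\<exists>a\<in>{i..n}. \<pi> a \<le> j)}"
  define M where "M = {(i, j). (i, j) \<in> L \<and> \<not> (\<exists>a\<in>{1..i}. j \<le> \<pi> a)}"
  have L: "right_ferrers n L"
    unfolding right_ferrers_def L_def
  proof (intro conjI allI impI)
    fix i j
    assume ij: "(i, j) \<in> {(i, j). i \<in> {1..n} \<and> j \<in> {1..n} \<and> (\<exists>a\<in>{i..n}. \<pi> a \<le> j)}"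
    then obtain a where a: "a \<in> {i..n}" "\<pi> a \<le> j" by blast
    show "(i, j + 1) \<in> {(i, j). i \<in> {1..n} \<and> j \<in> {1..n} \<and> (\<exists>a\<in>{i..n}. \<pi> a \<le> j)}" if "j < n"
      using ij a that by (auto intro!: bexI[of _ a])
    show "(i - 1, j) \<in> {(i, j). i \<in> {1..n} \<and> j \<in> {1..n} \<and> (\<exists>a\<in>{i..n}. \<pi> a \<le> j)}" if "1 < i"
      using ij a that by (auto intro!: bexI[of _ a])
  qed auto
  have M: "right_ferrers n M"
    unfolding right_ferrers_def
  proof (intro conjI allI impI)
    show "M \<subseteq> {1..n} \<times> {1..n}" unfolding M_def L_def by blast
    fix i j
    assume "(i, j) \<in> M"
    then have ij: "(i, j) \<in> L" and no: "\<And>a. a \<in> {1..i} \<Longrightarrow> \<pi> a < j"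
      unfolding M_def by force+
    show "(i, j + 1) \<in> M" if "j < n"
    proof -
      have "(i, j + 1) \<in> L" using L ij that unfolding right_ferrers_def by blast
      then show ?thesis using no unfolding M_def by fastforce
    qed
    show "(i - 1, j) \<in> M" if "1 < i"
    proof -
      have "(i - 1, j) \<in> L" using L ij that unfolding right_ferrers_def by blast
      then show ?thesis using no unfolding M_def by fastforce
    qed
  qed
  have "?H = L - M" unfolding L_def M_def by blast
  moreover have "M \<subseteq> L" unfolding M_def by blast
  ultimately have "right_skew_ferrers n ?H"
    using L M unfolding right_skew_ferrers_def by blast
  moreover have "covers n ?H \<pi>"
    using permutes_in_interval[OF p] unfolding covers_def by fastforce
  ultimately show "right_hull n \<pi> \<subseteq> ?H" by (rule right_hull_least(3)[OF p])
next
  obtain L M where L: "right_ferrers n L" and M: "right_ferrers n M"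
    and eq: "right_hull n \<pi> = L - M"
    using right_hull_least(1)[OF p] unfolding right_skew_ferrers_def by blast
  have cov: "(a, \<pi> a) \<in> L - M" if "a \<in> {1..n}" for a
    using right_hull_least(2)[OF p] that unfolding eq covers_def by blast
  show "?H \<subseteq> right_hull n \<pi>"
  proof clarify
    fix i j a b
    assume ij: "i \<in> {1..n}" "j \<in> {1..n}"
      and a: "a \<in> {i..n}" "\<pi> a \<le> j" and b: "b \<in> {1..i}" "j \<le> \<pi> b"
    have "(i, j) \<in> L"
      by (rule right_ferrers_closed[OF L, of a "\<pi> a"]) (use cov[of a] ij a in auto)
    moreover have "(i, j) \<notin> M"
    proof
      assume "(i, j) \<in> M"
      then have "(b, \<pi> b) \<in> M"
        by (rule right_ferrers_closed[OF M]) (use ij b permutes_in_interval[OF p, of b] in auto)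
      with cov[of b] ij b show False by auto
    qed
    ultimately show "(i, j) \<in> right_hull n \<pi>" unfolding eq by blast
  qed
qed

lemma rook_perms_right_hull_iff:
  assumes "\<pi> permutes {1..n}"
  shows "\<sigma> \<in> rook_perms n (right_hull n \<pi>) \<longleftrightarrow> \<sigma> permutes {1..n} \<and>
    (\<forall>i\<in>{1..n}. (\<exists>a\<in>{i..n}. \<pi> a \<le> \<sigma> i) \<and> (\<exists>a\<in>{1..i}. \<sigma> i \<le> \<pi> a))"
proof (cases "\<sigma> permutes {1..n}")
  case True
  have "(i, \<sigma> i) \<in> right_hull n \<pi> \<longleftrightarrow>
      (\<exists>a\<in>{i..n}. \<pi> a \<le> \<sigma> i) \<and> (\<exists>a\<in>{1..i}. \<sigma> i \<le> \<pi> a)" if "i \<in> {1..n}" for i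
    unfolding right_hull_eq[OF assms] using permutes_in_interval[OF True that] that by simp
  with True show ?thesis unfolding rook_perms_def covers_def by simp
qed (simp add: rook_perms_def)

subsection \<open>Rook counts in quadrants\<close>

text \<open>The north-west quadrant links the two counts: with the north-east one it holds all rooks
  of the rows up to \<open>i\<close>, with the south-west one all rooks left of column
  \<open>j\<close>, and both totals are the same for every permutation.\<close>

lemma ne_sw_balance:
  assumes "\<sigma> permutes {1..n}" "\<rho> permutes {1..n}"
  shows "ne_count n \<sigma> i j + sw_count n \<rho> i j = ne_count n \<rho> i j + sw_count n \<sigma> i j"
proof -
  define nw where "nw \<tau> = card {a \<in> {1..n}. a \<le> i \<and> \<tau> a < j}" for \<tau> :: "nat \<Rightarrow> nat"
  have rows: "ne_count n \<tau> i j + nw \<tau> = card {a \<in> {1..n}. a \<le> i}" for \<tau> :: "nat \<Rightarrow> nat"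
    unfolding ne_count_def nw_def
    by (subst card_Un_disjoint[symmetric]) (auto intro!: arg_cong[where f = card])
  have cols: "nw \<tau> + sw_count n \<tau> i j = card {v \<in> {1..n}. v < j}" if t: "\<tau> permutes {1..n}" for \<tau>
  proof -
    have "nw \<tau> + sw_count n \<tau> i j = card {a \<in> {1..n}. \<tau> a < j}"
      unfolding sw_count_def nw_def
      by (subst card_Un_disjoint[symmetric]) (auto intro!: arg_cong[where f = card])
    also have "\<dots> = card (\<tau> ` {a \<in> {1..n}. \<tau> a < j})"
      by (rule card_image[symmetric]) (rule inj_on_subset[OF permutes_inj[OF t]], simp)
    also have "\<tau> ` {a \<in> {1..n}. \<tau> a < j} = {v \<in> \<tau> ` {1..n}. v < j}" by blast
    also have "\<dots> = {v \<in> {1..n}. v < j}" by (simp only: permutes_image[OF t])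
    finally show ?thesis .
  qed
  show ?thesis using rows[of \<sigma>] rows[of \<rho>] cols[OF assms(1)] cols[OF assms(2)] by linarith
qed

lemma ne_count_pos_iff: "0 < ne_count n \<sigma> i j \<longleftrightarrow> (\<exists>a\<in>{1..n}. a \<le> i \<and> j \<le> \<sigma> a)"
  unfolding ne_count_def by (auto simp: card_gt_0_iff)

lemma sw_count_pos_iff: "0 < sw_count n \<sigma> i j \<longleftrightarrow> (\<exists>a\<in>{1..n}. i < a \<and> \<sigma> a < j)"
  unfolding sw_count_def by (auto simp: card_gt_0_iff)

text \<open>This and the next three lemmas move the cut by one line. A count changes by at most one,
  so dropping a line whose rook of \<pi> lies in the quadrant preserves an excess of
  \<sigma>.\<close>

lemma ne_count_row:
  assumes "Suc i \<le> n"
  shows "ne_count n \<sigma> (Suc i) j = ne_count n \<sigma> i j + (if j \<le> \<sigma> (Suc i) then 1 else 0)"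
proof -
  have "{a \<in> {1..n}. a \<le> Suc i \<and> j \<le> \<sigma> a} = (if j \<le> \<sigma> (Suc i)
      then insert (Suc i) {a \<in> {1..n}. a \<le> i \<and> j \<le> \<sigma> a} else {a \<in> {1..n}. a \<le> i \<and> j \<le> \<sigma> a})"
    using assms by (auto simp: le_Suc_eq)
  then show ?thesis unfolding ne_count_def by simp
qed

lemma ne_count_column:
  assumes "\<sigma> permutes {1..n}" "a \<in> {1..n}" "\<sigma> a = j"
  shows "ne_count n \<sigma> i j = ne_count n \<sigma> i (Suc j) + (if a \<le> i then 1 else 0)"
proof -
  have "b = a" if "\<sigma> b = j" for b using permutes_neq[OF assms(1)] assms(3) that by blast
  then have "j \<le> \<sigma> b \<longleftrightarrow> Suc j \<le> \<sigma> b \<or> b = a" for b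
    using assms(3) by (metis Suc_le_eq le_less)
  then have "{b \<in> {1..n}. b \<le> i \<and> j \<le> \<sigma> b} = (if a \<le> i
      then insert a {b \<in> {1..n}. b \<le> i \<and> Suc j \<le> \<sigma> b} else {b \<in> {1..n}. b \<le> i \<and> Suc j \<le> \<sigma> b})"
    using assms(2) by auto
  then show ?thesis using assms(3) unfolding ne_count_def by simp
qed

lemma sw_count_row:
  assumes "Suc i \<le> n"
  shows "sw_count n \<sigma> i j = sw_count n \<sigma> (Suc i) j + (if \<sigma> (Suc i) < j then 1 else 0)"
proof -
  have "{a \<in> {1..n}. i < a \<and> \<sigma> a < j} = (if \<sigma> (Suc i) < j
      then insert (Suc i) {a \<in> {1..n}. Suc i < a \<and> \<sigma> a < j} else {a \<in> {1..n}. Suc i < a \<and> \<sigma> a < j})"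
    using assms by (auto simp: less_Suc_eq dest: Suc_lessI)
  then show ?thesis unfolding sw_count_def by simp
qed

lemma sw_count_column:
  assumes "\<sigma> permutes {1..n}" "a \<in> {1..n}" "\<sigma> a = j"
  shows "sw_count n \<sigma> i (Suc j) = sw_count n \<sigma> i j + (if i < a then 1 else 0)"
proof -
  have "b = a" if "\<sigma> b = j" for b using permutes_neq[OF assms(1)] assms(3) that by blast
  then have "\<sigma> b < Suc j \<longleftrightarrow> \<sigma> b < j \<or> b = a" for b
    using assms(3) by (metis less_Suc_eq)
  then have "{b \<in> {1..n}. i < b \<and> \<sigma> b < Suc j} = (if i < a
      then insert a {b \<in> {1..n}. i < b \<and> \<sigma> b < j} else {b \<in> {1..n}. i < b \<and> \<sigma> b < j})"
    using assms(2) by auto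
  then show ?thesis using assms(3) unfolding sw_count_def by simp
qed

subsection \<open>The counting criterion for the Bruhat order\<close>

lemma inv_number_transpose_less:
  assumes kl: "k \<in> {1..n}" "l \<in> {1..n}" "k < l" "\<sigma> k < \<sigma> l"
  shows "inv_number n \<sigma> < inv_number n (\<sigma> \<circ> transpose k l)"
proof -
  define t where "t = transpose k l"
  define I where "I \<tau> = {(i, j). i \<in> {1..n} \<and> j \<in> {1..n} \<and> i < j \<and> \<tau> j < \<tau> i}" for \<tau> :: "nat \<Rightarrow> nat"
  \<comment> \<open>An inversion whose order \<open>t\<close> keeps is carried along by
    \<open>t\<close>; any other stays an inversion as it is. Applying \<open>t\<close> to the image
    tells the two cases apart, whence injectivity; the new inversion \<open>(k, l)\<close> is never
    hit.\<close>
  define \<phi> where "\<phi> = (\<lambda>(a, b). if t a < t b then (t a, t b) else (a, b))"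
  have tt: "t (t a) = a" for a unfolding t_def by simp
  have tn: "t a \<in> {1..n} \<longleftrightarrow> a \<in> {1..n}" for a
    using kl unfolding t_def transpose_def by auto
  have fin: "finite (I \<tau>)" for \<tau>
    by (rule finite_subset[of _ "{1..n} \<times> {1..n}"]) (auto simp: I_def)
  have "inj_on \<phi> (I \<sigma>)"
  proof (rule inj_onI, clarify)
    fix a b c d
    assume ab: "(a, b) \<in> I \<sigma>" and cd: "(c, d) \<in> I \<sigma>" and eq: "\<phi> (a, b) = \<phi> (c, d)"
    then have "a < b" "c < d" by (auto simp: I_def)
    with eq show "a = c \<and> b = d"
      unfolding \<phi>_def by (auto split: if_splits simp: tt dest: arg_cong[where f = t])
  qed
  moreover have "\<phi> ` I \<sigma> \<subseteq> I (\<sigma> \<circ> t) - {(k, l)}"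
  proof (rule image_subsetI)
    fix ab
    assume "ab \<in> I \<sigma>"
    then obtain a b where ab: "ab = (a, b)" and ab': "a \<in> {1..n}" "b \<in> {1..n}" "a < b" "\<sigma> b < \<sigma> a" unfolding I_def by blast
    show "\<phi> ab \<in> I (\<sigma> \<circ> t) - {(k, l)}"
    proof (cases "t a < t b")
      case True
      have "(t a, t b) \<noteq> (k, l)"
        using ab'(3) kl(3) tt[of a] tt[of b] unfolding t_def transpose_def by auto
      with True ab' show ?thesis using tn[of a] tn[of b] by (simp add: ab \<phi>_def I_def tt)
    next
      case False
      then have "(a = k \<and> b < l) \<or> (b = l \<and> k < a)"
        using ab' kl unfolding t_def transpose_def by (auto split: if_splits)
      with False ab' kl show ?thesis
        by (auto simp: ab \<phi>_def I_def t_def transpose_def)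
    qed
  qed
  ultimately have "card (I \<sigma>) \<le> card (I (\<sigma> \<circ> t) - {(k, l)})"
    using card_inj_on_le fin by blast
  moreover have "(k, l) \<in> I (\<sigma> \<circ> t)"
    using kl unfolding I_def t_def by simp
  ultimately have "card (I \<sigma>) < card (I (\<sigma> \<circ> t))"
    using card_Diff1_less[OF fin, of "(k, l)" "\<sigma> \<circ> t"] by linarith
  then show ?thesis unfolding I_def t_def inv_number_def .
qed

text \<open>Only two rooks move, to the other two corners of the rectangle they span; the quadrant
  gains one exactly when the cut separates both their rows and their columns.\<close>

lemma ne_count_transpose:
  assumes "\<sigma> permutes {1..n}" "k \<in> {1..n}" "l \<in> {1..n}" "k < l" "\<sigma> k < \<sigma> l"
  shows "ne_count n (\<sigma> \<circ> transpose k l) i j =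
    ne_count n \<sigma> i j + (if k \<le> i \<and> i < l \<and> \<sigma> k < j \<and> j \<le> \<sigma> l then 1 else 0)"
proof -
  let ?R = "{a \<in> {1..n} - {k, l}. a \<le> i \<and> j \<le> \<sigma> a}"
  have split: "ne_count n \<tau> i j = card ?R + (if k \<le> i \<and> j \<le> \<tau> k then 1 else 0)
      + (if l \<le> i \<and> j \<le> \<tau> l then 1 else 0)"
    if "\<And>a. a \<notin> {k, l} \<Longrightarrow> \<tau> a = \<sigma> a" for \<tau>
  proof -
    let ?K = "if k \<le> i \<and> j \<le> \<tau> k then {k} else {}" and ?L = "if l \<le> i \<and> j \<le> \<tau> l then {l} else {}"
    have "{a \<in> {1..n}. a \<le> i \<and> j \<le> \<tau> a} = ?R \<union> (?K \<union> ?L)" (is "?A = ?U")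
    proof (rule set_eqI)
      fix a
      show "a \<in> ?A \<longleftrightarrow> a \<in> ?U"
        using that[of a] assms(2,3) by (cases "a \<in> {k, l}") auto
    qed
    moreover have "card (?R \<union> (?K \<union> ?L)) = card ?R + card (?K \<union> ?L)"
      by (rule card_Un_disjoint) auto
    moreover have "card (?K \<union> ?L) = card ?K + card ?L"
      by (rule card_Un_disjoint) (use assms(4) in auto)
    ultimately show ?thesis unfolding ne_count_def by simp
  qed
  show ?thesis
    using assms(4,5) split[of \<sigma>] split[of "\<sigma> \<circ> transpose k l"]
    by (auto simp: transpose_def)
qed

lemma bruhat_step_ne_count_le:
  assumes "\<sigma> permutes {1..n}" "bruhat_step n \<sigma> \<rho>"
  shows "ne_count n \<sigma> i j \<le> ne_count n \<rho> i j"
proof -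
  obtain k l where kl: "k \<in> {1..n}" "l \<in> {1..n}" "k < l" "\<rho> = \<sigma> \<circ> transpose k l"
    and inv: "inv_number n \<sigma> < inv_number n \<rho>"
    using assms(2) unfolding bruhat_step_def
    by (metis linorder_neqE_nat transpose_commute)
  have "\<sigma> k < \<sigma> l"
  \<comment> \<open>Otherwise the same transposition would lead from \<rho> up to \<sigma>, against
    the growth of the inversion number.\<close>
  proof (rule ccontr)
    assume "\<not> \<sigma> k < \<sigma> l"
    with permutes_neq[OF assms(1), of k l] kl have "\<rho> k < \<rho> l" by auto
    from inv_number_transpose_less[of k n l \<rho>, OF kl(1-3) this] inv show False
      by (simp add: kl(4) comp_assoc)
  qed
  then show ?thesis using ne_count_transpose[OF assms(1) kl(1-3)] kl(4) by simp
qed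

lemma bruhat_le_ne_count_le:
  assumes "\<sigma> permutes {1..n}" "bruhat_le n \<sigma> \<rho>"
  shows "ne_count n \<sigma> i j \<le> ne_count n \<rho> i j"
proof -
  have "\<rho> permutes {1..n} \<and> ne_count n \<sigma> i j \<le> ne_count n \<rho> i j"
    using assms(2) unfolding bruhat_le_def
  proof (induction rule: rtranclp_induct)
    case base
    show ?case using assms(1) by simp
  next
    case (step \<tau> \<rho>)
    then have "\<rho> permutes {1..n}"
      unfolding bruhat_step_def
      by (auto intro!: permutes_compose permutes_swap_id)
    with step show ?case using bruhat_step_ne_count_le[of \<tau> n \<rho> i j] by fastforce
  qed
  then show ?thesis by blast
qed

lemma ne_count_split:
  assumes "j \<le> j'"
  shows "ne_count n \<sigma> i j = ne_count n \<sigma> i j' + card {a \<in> {1..n}. a \<le> i \<and> j \<le> \<sigma> a \<and> \<sigma> a < j'}"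
  unfolding ne_count_def using assms
  by (subst card_Un_disjoint[symmetric]) (auto intro!: arg_cong[where f = card])

text \<open>Let \<open>k\<close> be the first row where \<sigma> and \<pi> differ and
  \<open>l\<close> the next row whose value can be brought up to row \<open>k\<close> without
  overshooting \<open>\<pi> k\<close>. Swapping these rows raises only counts that were strictly
  below those of \<pi>.\<close>

lemma bruhat_step_below:
  assumes s: "\<sigma> permutes {1..n}" and p: "\<pi> permutes {1..n}" and neq: "\<sigma> \<noteq> \<pi>"
    and le: "\<And>i j. ne_count n \<sigma> i j \<le> ne_count n \<pi> i j"
  obtains \<rho> where "\<rho> permutes {1..n}" "bruhat_step n \<sigma> \<rho>"
    "\<And>i j. ne_count n \<rho> i j \<le> ne_count n \<pi> i j"
proof -
  define k where "k = (LEAST k. \<sigma> k \<noteq> \<pi> k)"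
  have "\<exists>k. \<sigma> k \<noteq> \<pi> k" using neq by blast
  then have k: "\<sigma> k \<noteq> \<pi> k" unfolding k_def by (rule LeastI_ex)
  have before: "\<sigma> a = \<pi> a" if "a < k" for a using not_less_Least that unfolding k_def by blast
  have kn: "k \<in> {1..n}" using k s p unfolding permutes_def by metis
  have "\<sigma> k < \<pi> k"
  \<comment> \<open>Otherwise the quadrant at \<open>(k, \<sigma> k)\<close> favours \<sigma>:
    earlier rows agree, and row \<open>k\<close> counts for \<sigma> alone.\<close>
  proof (rule ccontr)
    assume "\<not> \<sigma> k < \<pi> k"
    with k have gt: "\<pi> k < \<sigma> k" by simp
    have "{a \<in> {1..n}. a \<le> k \<and> \<sigma> k \<le> \<pi> a} \<subset> {a \<in> {1..n}. a \<le> k \<and> \<sigma> k \<le> \<sigma> a}"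
    proof
      show "{a \<in> {1..n}. a \<le> k \<and> \<sigma> k \<le> \<pi> a} \<subseteq> {a \<in> {1..n}. a \<le> k \<and> \<sigma> k \<le> \<sigma> a}"
        using before gt by (auto simp: le_less)
      show "{a \<in> {1..n}. a \<le> k \<and> \<sigma> k \<le> \<pi> a} \<noteq> {a \<in> {1..n}. a \<le> k \<and> \<sigma> k \<le> \<sigma> a}"
        using kn gt by (auto simp: set_eq_iff intro!: exI[of _ k])
    qed
    then have "ne_count n \<pi> k (\<sigma> k) < ne_count n \<sigma> k (\<sigma> k)"
      unfolding ne_count_def by (rule psubset_card_mono[rotated]) simp
    with le[of k "\<sigma> k"] show False by simp
  qed
  define l where "l = (LEAST l. k < l \<and> \<sigma> k < \<sigma> l \<and> \<sigma> l \<le> \<pi> k)"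
  obtain m where m: "m \<in> {1..n}" "\<sigma> m = \<pi> k"
    using permutes_preimage[OF s permutes_in_interval[OF p kn]] by blast
  have "k < m"
    using m before[of m] k permutes_neq[OF p, of m k] by (metis linorder_neqE_nat)
  then have "k < m \<and> \<sigma> k < \<sigma> m \<and> \<sigma> m \<le> \<pi> k" using m \<open>\<sigma> k < \<pi> k\<close> by simp
  then have l: "k < l \<and> \<sigma> k < \<sigma> l \<and> \<sigma> l \<le> \<pi> k" and "l \<le> m"
    unfolding l_def by (rule LeastI, rule Least_le)
  have ln: "l \<in> {1..n}" using l \<open>l \<le> m\<close> m by auto
  have between: "\<not> (\<sigma> k < \<sigma> a \<and> \<sigma> a \<le> \<pi> k)" if "k < a" "a < l" for a
    using not_less_Least[of a "\<lambda>l. k < l \<and> \<sigma> k < \<sigma> l \<and> \<sigma> l \<le> \<pi> k"] that unfolding l_def by blast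
  define \<rho> where "\<rho> = \<sigma> \<circ> transpose k l"
  have "\<rho> permutes {1..n}"
    unfolding \<rho>_def by (intro permutes_compose permutes_swap_id kn ln s)
  moreover have "bruhat_step n \<sigma> \<rho>"
    unfolding bruhat_step_def \<rho>_def
  proof (intro conjI bexI)
    show "inv_number n \<sigma> < inv_number n (\<sigma> \<circ> transpose k l)"
      by (rule inv_number_transpose_less) (use kn ln l in auto)
    show "k \<noteq> l" using l by simp
  qed (use kn ln in auto)
  moreover have "ne_count n \<rho> i j \<le> ne_count n \<pi> i j" for i j
  proof (cases "k \<le> i \<and> i < l \<and> \<sigma> k < j \<and> j \<le> \<sigma> l")
    case True
    \<comment> \<open>The strip of columns from \<open>j\<close> to \<open>\<pi> k\<close>. By the
      choice of \<open>l\<close>, the rooks of \<sigma> in it down to row \<open>i\<close> lie above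
      row \<open>k\<close>, where \<pi> agrees; \<pi> has the rook of row \<open>k\<close> in
      addition. East of the strip the hypothesis \<open>le\<close> applies.\<close>
    let ?S = "\<lambda>\<tau>. {a \<in> {1..n}. a \<le> i \<and> j \<le> \<tau> a \<and> \<tau> a < Suc (\<pi> k)}"
    have "?S \<sigma> \<subset> ?S \<pi>"
    proof
      show "?S \<sigma> \<subseteq> ?S \<pi>"
      proof
        fix a assume a: "a \<in> ?S \<sigma>"
        with True have "a \<noteq> k" by auto
        moreover have "\<not> k < a" using between[of a] a True by auto
        ultimately have "a < k" by simp
        with a before[of a] show "a \<in> ?S \<pi>" by simp
      qed
      have "k \<in> ?S \<pi>" "k \<notin> ?S \<sigma>" using True kn l by auto
      then show "?S \<sigma> \<noteq> ?S \<pi>" by blast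
    qed
    then have "card (?S \<sigma>) < card (?S \<pi>)" by (rule psubset_card_mono[rotated]) simp
    moreover have "j \<le> Suc (\<pi> k)" using True l by simp
    ultimately have "ne_count n \<sigma> i j < ne_count n \<pi> i j"
      using le[of i "Suc (\<pi> k)"] by (simp add: ne_count_split[of j "Suc (\<pi> k)"])
    then show ?thesis using ne_count_transpose[OF s kn ln] l unfolding \<rho>_def by simp
  next
    case False
    have "ne_count n \<rho> i j = ne_count n \<sigma> i j"
      unfolding \<rho>_def using ne_count_transpose[OF s kn ln, of i j] l by (simp only: False if_False)
    then show ?thesis using le[of i j] by simp
  qed
  ultimately show ?thesis by (rule that)
qed

lemma inv_number_le: "inv_number n \<sigma> \<le> n * n"
proof -
  have "inv_number n \<sigma> \<le> card ({1..n} \<times> {1..n})"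
    unfolding inv_number_def by (rule card_mono) auto
  then show ?thesis by simp
qed

text \<open>Repeated steps of \<open>bruhat_step_below\<close> must end at \<pi>, since the
  inversion number grows and is at most \<open>n * n\<close>.\<close>

lemma ne_count_le_bruhat_le:
  assumes "\<sigma> permutes {1..n}" "\<pi> permutes {1..n}"
    and "\<And>i j. ne_count n \<sigma> i j \<le> ne_count n \<pi> i j"
  shows "bruhat_le n \<sigma> \<pi>"
  using assms(1,3)
proof (induction "n * n - inv_number n \<sigma>" arbitrary: \<sigma> rule: less_induct)
  case less
  show ?case
  proof (cases "\<sigma> = \<pi>")
    case True
    then show ?thesis unfolding bruhat_le_def by simp
  next
    case False
    then obtain \<rho> where \<rho>: "\<rho> permutes {1..n}" "bruhat_step n \<sigma> \<rho>"
      "\<And>i j. ne_count n \<rho> i j \<le> ne_count n \<pi> i j"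
      using bruhat_step_below[OF less.prems(1) assms(2) False less.prems(2)] by blast
    then have "n * n - inv_number n \<rho> < n * n - inv_number n \<sigma>"
      using inv_number_le[of n \<rho>] unfolding bruhat_step_def by linarith
    from \<rho>(2) less.hyps[OF this \<rho>(1,3)] show ?thesis
      unfolding bruhat_le_def by (rule converse_rtranclp_into_rtranclp)
  qed
qed

lemma lower_bruhat_interval_iff:
  assumes "\<pi> permutes {1..n}"
  shows "\<sigma> \<in> lower_bruhat_interval n \<pi> \<longleftrightarrow>
    \<sigma> permutes {1..n} \<and> (\<forall>i j. ne_count n \<sigma> i j \<le> ne_count n \<pi> i j)"
proof
  assume "\<sigma> \<in> lower_bruhat_interval n \<pi>"
  then show "\<sigma> permutes {1..n} \<and> (\<forall>i j. ne_count n \<sigma> i j \<le> ne_count n \<pi> i j)"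
    unfolding lower_bruhat_interval_def by (simp add: bruhat_le_ne_count_le)
next
  assume "\<sigma> permutes {1..n} \<and> (\<forall>i j. ne_count n \<sigma> i j \<le> ne_count n \<pi> i j)"
  then show "\<sigma> \<in> lower_bruhat_interval n \<pi>"
    using ne_count_le_bruhat_le[OF _ assms] unfolding lower_bruhat_interval_def by simp
qed

lemma lower_bruhat_interval_subset_rook_perms:
  assumes p: "\<pi> permutes {1..n}"
  shows "lower_bruhat_interval n \<pi> \<subseteq> rook_perms n (right_hull n \<pi>)"
proof
  fix \<sigma> assume "\<sigma> \<in> lower_bruhat_interval n \<pi>"
  then have s: "\<sigma> permutes {1..n}" and le: "\<And>i j. ne_count n \<sigma> i j \<le> ne_count n \<pi> i j"
    using lower_bruhat_interval_iff[OF p] by auto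
  have "(\<exists>a\<in>{i..n}. \<pi> a \<le> \<sigma> i) \<and> (\<exists>a\<in>{1..i}. \<sigma> i \<le> \<pi> a)" if i: "i \<in> {1..n}" for i
  proof
    \<comment> \<open>The shifts by one turn the strict quadrant into the weak one at
      \<open>(i, \<sigma> i)\<close>; the balance reverses domination in neither quadrant.\<close>
    have "0 < sw_count n \<sigma> (i - 1) (Suc (\<sigma> i))"
      using i unfolding sw_count_pos_iff by (intro bexI[of _ i]) auto
    then have "0 < sw_count n \<pi> (i - 1) (Suc (\<sigma> i))"
      using ne_sw_balance[OF s p, of "i - 1" "Suc (\<sigma> i)"] le[of "i - 1" "Suc (\<sigma> i)"] by linarith
    then obtain a where "a \<in> {1..n}" "i - 1 < a" "\<pi> a < Suc (\<sigma> i)"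
      unfolding sw_count_pos_iff by blast
    then show "\<exists>a\<in>{i..n}. \<pi> a \<le> \<sigma> i" by (intro bexI[of _ a]) auto
    have "0 < ne_count n \<sigma> i (\<sigma> i)" using i unfolding ne_count_pos_iff by auto
    then have "0 < ne_count n \<pi> i (\<sigma> i)" using le[of i "\<sigma> i"] by linarith
    then show "\<exists>a\<in>{1..i}. \<sigma> i \<le> \<pi> a" unfolding ne_count_pos_iff by force
  qed
  with s show "\<sigma> \<in> rook_perms n (right_hull n \<pi>)" unfolding rook_perms_right_hull_iff[OF p] by blast
qed

subsection \<open>Patterns obstruct equality\<close>

text \<open>Reduces the obstruction to a finite check on the pattern: permuting its letters by
  \<open>g\<close> stays in the hull of \<open>p\<close> (\<open>hull\<close>) and overfills the
  quadrant of positions up to \<open>u\<close> and values from \<open>p ! v\<close>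
  (\<open>more\<close>).\<close>

lemma pattern_rearrangement_exceeds:
  assumes p: "\<pi> permutes {1..n}" and "contains_pattern n \<pi> p"
    and g: "g permutes {..<length p}"
    and hull: "\<forall>a<length p. (\<exists>b\<le>a. p ! (g a) \<le> p ! b) \<and> (\<exists>b<length p. a \<le> b \<and> p ! b \<le> p ! (g a))"
    and u: "u < length p" and v: "v < length p"
    and more: "card {a. a \<le> u \<and> p ! v \<le> p ! a} < card {a. a \<le> u \<and> p ! v \<le> p ! (g a)}"
  shows "\<not> rook_perms n (right_hull n \<pi>) \<subseteq> lower_bruhat_interval n \<pi>"
proof -
  let ?m = "length p"
  obtain f where mono: "strict_mono_on {..<?m} f" and fn: "f ` {..<?m} \<subseteq> {1..n}"
    and ord: "\<forall>a<?m. \<forall>b<?m. \<pi> (f a) < \<pi> (f b) \<longleftrightarrow> p ! a < p ! b"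
    using assms(2) unfolding contains_pattern_def by (elim exE conjE)
  have ord': "\<pi> (f a) \<le> \<pi> (f b) \<longleftrightarrow> p ! a \<le> p ! b" if "a < ?m" "b < ?m" for a b
    using ord that by (metis not_less)
  have fle: "f a \<le> f b \<longleftrightarrow> a \<le> b" if "a < ?m" "b < ?m" for a b
    using strict_mono_on_less_eq[OF mono] that by simp
  have inj: "inj_on f {..<?m}" using mono by (rule strict_mono_on_imp_inj_on)
  have fn': "1 \<le> f a \<and> f a \<le> n" if "a < ?m" for a using fn that by (auto simp: image_subset_iff)
  have gm: "g a < ?m" if "a < ?m" for a using permutes_in_image[OF g, of a] that by simp
  \<comment> \<open>The conjugate of \<open>g\<close> by the occurrence \<open>f\<close>, extended
    by the identity.\<close>
  define \<tau> where "\<tau> x = (if x \<in> f ` {..<?m} then f (g (inv_into {..<?m} f x)) else x)" for x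
  have \<tau>f: "\<tau> (f a) = f (g a)" if "a < ?m" for a
    unfolding \<tau>_def using that inj by simp
  have "\<tau> permutes f ` {..<?m}"
    unfolding \<tau>_def by (rule permutes_bij_inv_into[OF g]) (simp add: inj bij_betw_def)
  then have \<tau>: "\<tau> permutes {1..n}" using fn by (rule permutes_subset)
  define \<sigma> where "\<sigma> = \<pi> \<circ> \<tau>"
  have s: "\<sigma> permutes {1..n}" unfolding \<sigma>_def by (rule permutes_compose[OF \<tau> p])
  have \<sigma>f: "\<sigma> (f a) = \<pi> (f (g a))" if "a < ?m" for a unfolding \<sigma>_def using \<tau>f that by simp
  have out: "\<sigma> x = \<pi> x" if "x \<notin> f ` {..<?m}" for x unfolding \<sigma>_def \<tau>_def using that by simp
  have "(\<exists>a\<in>{i..n}. \<pi> a \<le> \<sigma> i) \<and> (\<exists>a\<in>{1..i}. \<sigma> i \<le> \<pi> a)" if i: "i \<in> {1..n}" for i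
  proof (cases "i \<in> f ` {..<?m}")
    case True
    then obtain a where a: "a < ?m" "i = f a" by auto
    with hull obtain b c where b: "b \<le> a" "p ! (g a) \<le> p ! b"
      and c: "c < ?m" "a \<le> c" "p ! c \<le> p ! (g a)" by blast
    have "f b \<in> {1..i}" "\<sigma> i \<le> \<pi> (f b)"
      using a b fn' fle[of b a] ord'[of "g a" b] gm \<sigma>f by auto
    moreover have "f c \<in> {i..n}" "\<pi> (f c) \<le> \<sigma> i"
      using a c fn' fle[of a c] ord'[of c "g a"] gm \<sigma>f by auto
    ultimately show ?thesis by blast
  next
    case False
    then show ?thesis using out i by force
  qed
  then have "\<sigma> \<in> rook_perms n (right_hull n \<pi>)"
    unfolding rook_perms_right_hull_iff[OF p] using s by blast
  moreover have "ne_count n \<pi> (f u) (\<pi> (f v)) < ne_count n \<sigma> (f u) (\<pi> (f v))"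
  proof -
    \<comment> \<open>Rooks outside the occurrence contribute equally; those inside are counted in
      the pattern. It is applied to \<pi> with the identity as \<open>h\<close> and to \<sigma> with
      \<open>g\<close>.\<close>
    have split: "ne_count n \<rho> (f u) (\<pi> (f v)) =
        card {x \<in> {1..n} - f ` {..<?m}. x \<le> f u \<and> \<pi> (f v) \<le> \<pi> x} + card {a. a \<le> u \<and> p ! v \<le> p ! (h a)}"
      if h: "\<And>a. a < ?m \<Longrightarrow> h a < ?m \<and> \<rho> (f a) = \<pi> (f (h a))"
        and o: "\<And>x. x \<notin> f ` {..<?m} \<Longrightarrow> \<rho> x = \<pi> x" for \<rho> h
    proof -
      let ?R = "{x \<in> {1..n} - f ` {..<?m}. x \<le> f u \<and> \<pi> (f v) \<le> \<pi> x}"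
      let ?T = "{a. a \<le> u \<and> p ! v \<le> p ! (h a)}"
      have Tm: "?T \<subseteq> {..<?m}" using u by auto
      have "{x \<in> {1..n}. x \<le> f u \<and> \<pi> (f v) \<le> \<rho> x} = ?R \<union> f ` ?T" (is "?L = _")
      proof (rule set_eqI)
        fix x
        show "x \<in> ?L \<longleftrightarrow> x \<in> ?R \<union> f ` ?T"
        proof (cases "x \<in> f ` {..<?m}")
          case True
          then obtain a where a: "a < ?m" "x = f a" by auto
          have "f a \<in> f ` ?T \<longleftrightarrow> a \<in> ?T"
            using inj_on_image_mem_iff[OF inj _ Tm] a by simp
          moreover have "f a \<in> ?L \<longleftrightarrow> a \<in> ?T"
            using a fn'[OF a(1)] fle[OF a(1) u] h[OF a(1)] ord'[OF v, of "h a"] by auto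
          moreover have "f a \<notin> ?R" using a by simp
          ultimately show ?thesis unfolding a(2) by blast
        next
          case False
          then show ?thesis using o Tm by auto
        qed
      qed
      moreover have "finite ?T" using Tm finite_subset by blast
      moreover have "card (f ` ?T) = card ?T" using card_image[OF inj_on_subset[OF inj Tm]] .
      moreover have "?R \<inter> f ` ?T = {}" using Tm by auto
      ultimately show ?thesis unfolding ne_count_def by (simp add: card_Un_disjoint)
    qed
    show ?thesis
      using split[of "\<lambda>a. a" \<pi>] split[of g \<sigma>] gm \<sigma>f out more by simp
  qed
  ultimately show ?thesis
    unfolding subset_iff lower_bruhat_interval_iff[OF p] by (meson not_le)
qed

text \<open>The permutations \<open>g\<close> turn the patterns into 4321, 15432, 43215 and 154326.
  Positions count from 0; each time the first \<open>u + 1\<close> letters contain two values at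
  least \<open>p ! v\<close> instead of one.\<close>

lemma rook_perms_subset_imp_avoids:
  assumes p: "\<pi> permutes {1..n}"
    and sub: "rook_perms n (right_hull n \<pi>) \<subseteq> lower_bruhat_interval n \<pi>"
  shows "avoids_pattern n \<pi> [4, 2, 3, 1]" and "avoids_pattern n \<pi> [3, 5, 1, 4, 2]"
    and "avoids_pattern n \<pi> [4, 2, 5, 1, 3]" and "avoids_pattern n \<pi> [3, 5, 1, 6, 2, 4]"
proof -
  \<comment> \<open>With \<open>upto\<close>, this unfolds the conditions on concrete patterns into
    finite computations.\<close>
  have ex_le: "(\<exists>b\<le>Suc k. P b) \<longleftrightarrow> P (Suc k) \<or> (\<exists>b\<le>k. P b)" for P and k :: nat
    by (auto simp: le_Suc_eq)
  have upto: "{a. a \<le> u \<and> P a} = set (filter P [0..<Suc u])" for u :: nat and P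
    by (auto simp: less_Suc_eq_le simp del: upt_Suc)
  note rearrange = pattern_rearrangement_exceeds[OF p]
  note swap = permutes_swap_id permutes_compose
  note compute = transpose_def numeral_eq_Suc All_less_Suc Ex_less_Suc ex_le upto
  show "avoids_pattern n \<pi> [4, 2, 3, 1]"
  proof
    assume "contains_pattern n \<pi> [4, 2, 3, 1]"
    then have "\<not> rook_perms n (right_hull n \<pi>) \<subseteq> lower_bruhat_interval n \<pi>"
      by (rule rearrange[where g = "transpose 1 2" and u = 1 and v = 2])
        (auto simp: compute intro!: swap)
    with sub show False by blast
  qed
  show "avoids_pattern n \<pi> [3, 5, 1, 4, 2]"
  proof
    assume "contains_pattern n \<pi> [3, 5, 1, 4, 2]"
    then have "\<not> rook_perms n (right_hull n \<pi>) \<subseteq> lower_bruhat_interval n \<pi>"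
      by (rule rearrange[where g = "transpose 0 2 \<circ> transpose 2 3" and u = 2 and v = 3])
        (auto simp: compute intro!: swap)
    with sub show False by blast
  qed
  show "avoids_pattern n \<pi> [4, 2, 5, 1, 3]"
  proof
    assume "contains_pattern n \<pi> [4, 2, 5, 1, 3]"
    then have "\<not> rook_perms n (right_hull n \<pi>) \<subseteq> lower_bruhat_interval n \<pi>"
      by (rule rearrange[where g = "transpose 1 4 \<circ> transpose 2 4" and u = 1 and v = 4])
        (auto simp: compute intro!: swap)
    with sub show False by blast
  qed
  show "avoids_pattern n \<pi> [3, 5, 1, 6, 2, 4]"
  proof
    assume "contains_pattern n \<pi> [3, 5, 1, 6, 2, 4]"
    then have "\<not> rook_perms n (right_hull n \<pi>) \<subseteq> lower_bruhat_interval n \<pi>"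
      by (rule rearrange[where g = "transpose 0 2 \<circ> transpose 2 5 \<circ> transpose 5 3" and u = 2 and v = 5])
        (auto simp: compute intro!: swap)
    with sub show False by blast
  qed
qed

subsection \<open>Avoidance implies equality\<close>

lemma contains_patternI:
  assumes "length xs = length p" "sorted_wrt (<) xs" "set xs \<subseteq> {1..n}"
    and "\<forall>a<length p. \<forall>b<length p. \<pi> (xs ! a) < \<pi> (xs ! b) \<longleftrightarrow> p ! a < p ! b"
  shows "contains_pattern n \<pi> p"
  unfolding contains_pattern_def
proof (intro exI[of _ "(!) xs"] conjI)
  show "strict_mono_on {..<length p} ((!) xs)"
    using assms(1,2) by (auto simp: strict_mono_on_def sorted_wrt_iff_nth_less)
  show "(!) xs ` {..<length p} \<subseteq> {1..n}"
    using assms(1,3) by (auto simp: subset_iff)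
qed (use assms(4) in blast)

text \<open>Here \<open>x\<close> is north-east and \<open>y\<close> south-west of the cut,
  \<open>b\<close> and \<open>b'\<close> are north-west, \<open>c\<close> and \<open>c'\<close>
  south-east. In each of the last two quadrants either one rook lies inside the rectangle spanned by
  \<open>x\<close> and \<open>y\<close>, or two rooks miss it on different sides; the four
  combinations are the four patterns.\<close>

lemma rooks_around_corner_contain_pattern:
  assumes inj: "inj \<pi>" and bounds: "1 \<le> b" "1 \<le> b'" "1 \<le> x" "c \<le> n" "c' \<le> n" "y \<le> n"
    and x: "x \<le> i" "j \<le> \<pi> x" and y: "i < y" "\<pi> y < j"
    and b: "x < b" "b \<le> i" "\<pi> b < j" and b': "b' \<le> i" "\<pi> y < \<pi> b'" "\<pi> b' < j"
    and c: "i < c" "j \<le> \<pi> c" "\<pi> c < \<pi> x" and c': "i < c'" "c' < y" "j \<le> \<pi> c'"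
  shows "contains_pattern n \<pi> [4, 2, 3, 1] \<or> contains_pattern n \<pi> [3, 5, 1, 4, 2] \<or>
    contains_pattern n \<pi> [4, 2, 5, 1, 3] \<or> contains_pattern n \<pi> [3, 5, 1, 6, 2, 4]"
proof -
  note compute = numeral_eq_Suc All_less_Suc
  have b_or: "(\<exists>d. x < d \<and> d \<le> i \<and> \<pi> y < \<pi> d \<and> \<pi> d < j) \<or> (\<pi> b < \<pi> y \<and> b' < x)"
  proof -
    have "\<pi> b \<noteq> \<pi> y" using injD[OF inj, of b y] b y by auto
    moreover have "b' \<noteq> x" using b' x by auto
    ultimately show ?thesis using b b' by (meson linorder_neqE_nat)
  qed
  have c_or: "(\<exists>d. i < d \<and> d < y \<and> j \<le> \<pi> d \<and> \<pi> d < \<pi> x) \<or> (\<pi> x < \<pi> c' \<and> y < c)"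
  proof -
    have "\<pi> c' \<noteq> \<pi> x" using injD[OF inj, of c' x] c' x by auto
    moreover have "c \<noteq> y" using c y by auto
    ultimately show ?thesis using c c' by (meson linorder_neqE_nat)
  qed
  from b_or c_or consider
    (1) d e where "x < d" "d \<le> i" "\<pi> y < \<pi> d" "\<pi> d < j" "i < e" "e < y" "j \<le> \<pi> e" "\<pi> e < \<pi> x"
  | (2) e where "\<pi> b < \<pi> y" "b' < x" "i < e" "e < y" "j \<le> \<pi> e" "\<pi> e < \<pi> x"
  | (3) d where "x < d" "d \<le> i" "\<pi> y < \<pi> d" "\<pi> d < j" "\<pi> x < \<pi> c'" "y < c"
  | (4) "\<pi> b < \<pi> y" "b' < x" "\<pi> x < \<pi> c'" "y < c"
    by blast
  then show ?thesis
  proof cases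
    case 1
    then have "contains_pattern n \<pi> [4, 2, 3, 1]"
      using bounds by (intro contains_patternI[of "[x, d, e, y]"]) (auto simp: compute)
    then show ?thesis by blast
  next
    case 2
    then have "contains_pattern n \<pi> [3, 5, 1, 4, 2]"
      using assms by (intro contains_patternI[of "[b', x, b, e, y]"]) (auto simp: compute)
    then show ?thesis by blast
  next
    case 3
    then have "contains_pattern n \<pi> [4, 2, 5, 1, 3]"
      using assms by (intro contains_patternI[of "[x, d, c', y, c]"]) (auto simp: compute)
    then show ?thesis by blast
  next
    case 4
    then have "contains_pattern n \<pi> [3, 5, 1, 6, 2, 4]"
      using assms by (intro contains_patternI[of "[b', x, b, c', y, c]"]) (auto simp: compute)
    then show ?thesis by blast
  qed
qed

lemma ex_minimizing_pair:
  fixes m :: "'a \<Rightarrow> 'b \<Rightarrow> nat"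
  assumes "Q i j"
  shows "\<exists>i j. Q i j \<and> (\<forall>i' j'. Q i' j' \<longrightarrow> m i j \<le> m i' j')"
proof -
  obtain z where "case_prod Q z" "\<forall>w. case_prod Q w \<longrightarrow> case_prod m z \<le> case_prod m w"
    using ex_has_least_nat[of "case_prod Q" "(i, j)" "case_prod m"] assms by auto
  then show ?thesis by (cases z) auto
qed

lemma exceeding_rook_perm_imp_pattern:
  assumes p: "\<pi> permutes {1..n}" and "\<sigma> \<in> rook_perms n (right_hull n \<pi>)"
    and "\<sigma> \<notin> lower_bruhat_interval n \<pi>"
  shows "contains_pattern n \<pi> [4, 2, 3, 1] \<or> contains_pattern n \<pi> [3, 5, 1, 4, 2] \<or>
    contains_pattern n \<pi> [4, 2, 5, 1, 3] \<or> contains_pattern n \<pi> [3, 5, 1, 6, 2, 4]"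
proof -
  have s: "\<sigma> permutes {1..n}"
    and sw: "\<And>i. i \<in> {1..n} \<Longrightarrow> \<exists>a\<in>{i..n}. \<pi> a \<le> \<sigma> i"
    and ne: "\<And>i. i \<in> {1..n} \<Longrightarrow> \<exists>a\<in>{1..i}. \<sigma> i \<le> \<pi> a"
    using assms(2) rook_perms_right_hull_iff[OF p] by auto
  define V where "V i j \<longleftrightarrow> i \<le> n \<and> ne_count n \<pi> i j < ne_count n \<sigma> i j" for i j
  have V_sw: "V i j \<longleftrightarrow> i \<le> n \<and> sw_count n \<pi> i j < sw_count n \<sigma> i j" for i j
    using ne_sw_balance[OF p s, of i j] unfolding V_def by linarith
  \<comment> \<open>The hull condition enters here: the excess yields a rook of \<sigma> in the
    quadrant, and the hull a rook of \<pi> further north-east.\<close>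
  have ex_ne: "\<exists>x\<in>{1..n}. x \<le> i \<and> j \<le> \<pi> x" if "V i j" for i j
  proof -
    have "0 < ne_count n \<sigma> i j" using that unfolding V_def by simp
    then obtain a where a: "a \<in> {1..n}" "a \<le> i" "j \<le> \<sigma> a" unfolding ne_count_pos_iff by blast
    obtain x where "x \<in> {1..a}" "\<sigma> a \<le> \<pi> x" using ne[OF a(1)] by blast
    with a show ?thesis by (intro bexI[of _ x]) auto
  qed
  have ex_sw: "\<exists>y\<in>{1..n}. i < y \<and> \<pi> y < j" if "V i j" for i j
  proof -
    have "0 < sw_count n \<sigma> i j" using that unfolding V_sw by simp
    then obtain a where a: "a \<in> {1..n}" "i < a" "\<sigma> a < j" unfolding sw_count_pos_iff by blast
    obtain y where "y \<in> {a..n}" "\<pi> y \<le> \<sigma> a" using sw[OF a(1)] by blast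
    with a show ?thesis by (intro bexI[of _ y]) auto
  qed
  have range: "i \<in> {1..<n}" "j \<in> {2..n}" if V: "V i j" for i j
  proof -
    obtain x y where "x \<in> {1..n}" "x \<le> i" "j \<le> \<pi> x" "y \<in> {1..n}" "i < y" "\<pi> y < j"
      using ex_ne[OF V] ex_sw[OF V] by blast
    then show "i \<in> {1..<n}" "j \<in> {2..n}"
      using permutes_in_interval[OF p, of x] permutes_in_interval[OF p, of y] by auto
  qed

  have "\<exists>i j. V i j"
  proof -
    obtain i j where ij: "ne_count n \<pi> i j < ne_count n \<sigma> i j"
      using assms(3) s lower_bruhat_interval_iff[OF p] by (meson not_le)
    have "ne_count n \<tau> i j = ne_count n \<tau> (min i n) j" for \<tau>
      unfolding ne_count_def by (rule arg_cong[where f = card]) auto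
    with ij have "V (min i n) j" unfolding V_def by simp
    then show ?thesis by blast
  qed
  \<comment> \<open>First shrinking: an exceeded north-east quadrant with fewest rooks of
    \<pi>.\<close>
  then obtain i j where V: "V i j"
    and min: "\<And>i' j'. V i' j' \<Longrightarrow> ne_count n \<pi> i j \<le> ne_count n \<pi> i' j'"
    using ex_minimizing_pair[of V _ _ "ne_count n \<pi>"] by metis
  have jn: "j \<in> {1..n}" using range(2)[OF V] by simp
  have row: "\<pi> i < j"
  proof (rule ccontr)
    assume "\<not> \<pi> i < j"
    moreover obtain i' where i': "i = Suc i'" "Suc i' \<le> n" using range(1)[OF V] by (cases i) auto
    ultimately have "V i' j" "ne_count n \<pi> i' j < ne_count n \<pi> i j"
      using V ne_count_row[of i' n \<pi> j] ne_count_row[of i' n \<sigma> j] unfolding V_def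
      by (auto split: if_splits)
    with min[of i' j] show False by simp
  qed
  obtain c where c: "c \<in> {1..n}" "\<pi> c = j"
    using permutes_preimage[OF p] jn by blast
  have col: "i < c"
  proof (rule ccontr)
    assume "\<not> i < c"
    moreover obtain d where "d \<in> {1..n}" "\<sigma> d = j"
      using permutes_preimage[OF s] jn by blast
    ultimately have "V i (Suc j)" "ne_count n \<pi> i (Suc j) < ne_count n \<pi> i j"
      using V ne_count_column[OF p c, of i] ne_count_column[OF s, of d j i] unfolding V_def
      by (auto split: if_splits)
    with min[of i "Suc j"] show False by simp
  qed

  \<comment> \<open>\<open>P\<close> records what the first shrinking has achieved in a form that survives the second one.\<close>
  define P where "P i j \<longleftrightarrow> (\<exists>x b c. x \<in> {1..n} \<and> b \<in> {1..n} \<and> c \<in> {1..n} \<and> x \<le> i \<and> j \<le> \<pi> x \<and>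
    x < b \<and> b \<le> i \<and> \<pi> b < j \<and> i < c \<and> j \<le> \<pi> c \<and> \<pi> c < \<pi> x)" for i j
  obtain x where x: "x \<in> {1..n}" "x \<le> i" "j \<le> \<pi> x" using ex_ne[OF V] by blast
  \<comment> \<open>The rook of row \<open>i\<close> serves as \<open>b\<close>, that of column
    \<open>j\<close> as \<open>c\<close>.\<close>
  have "x < i" using x row by (metis le_neq_implies_less not_le)
  moreover have "\<pi> c < \<pi> x" using x c col permutes_neq[OF p, of c x] by fastforce
  ultimately have "P i j"
    unfolding P_def using x c col row range(1)[OF V]
    by (intro exI[of _ x] exI[of _ i] exI[of _ c]) auto
  \<comment> \<open>Second shrinking, now of the south-west quadrant, among the exceeded cuts that
    still satisfy \<open>P\<close>.\<close>
  with V obtain k l where V': "V k l" and P: "P k l"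
    and min': "\<And>i' j'. V i' j' \<Longrightarrow> P i' j' \<Longrightarrow> sw_count n \<pi> k l \<le> sw_count n \<pi> i' j'"
    using ex_minimizing_pair[of "\<lambda>i j. V i j \<and> P i j" i j "sw_count n \<pi>"] by metis
  from P obtain x b c where xbc: "x \<in> {1..n}" "b \<in> {1..n}" "c \<in> {1..n}" "x \<le> k" "l \<le> \<pi> x"
    "x < b" "b \<le> k" "\<pi> b < l" "k < c" "l \<le> \<pi> c" "\<pi> c < \<pi> x"
    unfolding P_def by blast
  have kn: "Suc k \<in> {1..n}" using range(1)[OF V'] by auto
  have row': "l \<le> \<pi> (Suc k)"
  proof (rule ccontr)
    assume neg: "\<not> l \<le> \<pi> (Suc k)"
    then have "V (Suc k) l" "sw_count n \<pi> (Suc k) l < sw_count n \<pi> k l"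
      using V' kn sw_count_row[of k n \<pi> l] sw_count_row[of k n \<sigma> l] unfolding V_sw
      by (auto split: if_splits)
    moreover have "P (Suc k) l"
    proof -
      \<comment> \<open>The rook in row \<open>Suc k\<close> is west of the cut and that of
        \<open>c\<close> is not, so \<open>c\<close> stays below the lowered cut.\<close>
      have "c \<noteq> Suc k" using neg xbc by auto
      then show ?thesis unfolding P_def using xbc
        by (intro exI[of _ x] exI[of _ b] exI[of _ c]) auto
    qed
    ultimately show False using min'[of "Suc k" l] by simp
  qed
  \<comment> \<open>The last column of the south-west quadrant; minimality forces its rook into the
    north-west.\<close>
  obtain m where m: "l = Suc m" "m \<in> {1..n}" using range(2)[OF V'] by (cases l) auto
  obtain b' where b': "b' \<in> {1..n}" "\<pi> b' = m" using permutes_preimage[OF p m(2)] .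
  have col': "b' \<le> k"
  proof (rule ccontr)
    assume neg: "\<not> b' \<le> k"
    obtain d where "d \<in> {1..n}" "\<sigma> d = m" using permutes_preimage[OF s m(2)] .
    with neg have "V k m" "sw_count n \<pi> k m < sw_count n \<pi> k l"
      using V' sw_count_column[OF p b', of k] sw_count_column[OF s, of d m k] unfolding V_sw m(1)
      by (auto split: if_splits)
    moreover have "P k m"
    proof -
      have "\<pi> b \<noteq> m" using neg xbc b' permutes_neq[OF p, of b b'] by auto
      then show ?thesis unfolding P_def using xbc m
        by (intro exI[of _ x] exI[of _ b] exI[of _ c]) auto
    qed
    ultimately show False using min'[of k m] by simp
  qed
  obtain y where y: "y \<in> {1..n}" "k < y" "\<pi> y < l" using ex_sw[OF V'] by blast
  \<comment> \<open>The rook of row \<open>Suc k\<close> is south-east and becomes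
    \<open>c'\<close>; \<open>y\<close> is thus below it and, likewise, west of the rook of
    \<open>b'\<close>.\<close>
  have "Suc k < y" using y row' by (metis Suc_lessI not_le)
  moreover have "\<pi> y < \<pi> b'" using y m b' col' permutes_neq[OF p, of y b'] by fastforce
  ultimately show ?thesis
    using xbc y kn row' m b' col'
    by (intro rooks_around_corner_contain_pattern[OF permutes_inj[OF p],
          where x = x and b = b and c = c and y = y and b' = b' and c' = "Suc k" and i = k and j = l]) auto
qed

theorem theorem3p1:
  fixes n :: nat and \<pi> :: "nat \<Rightarrow> nat"
  assumes "n \<ge> 1" and "\<pi> permutes {1..n}"
  shows "rook_perms n (right_hull n \<pi>) = lower_bruhat_interval n \<pi> \<longleftrightarrow>
    avoids_pattern n \<pi> [4, 2, 3, 1] \<and>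
    avoids_pattern n \<pi> [3, 5, 1, 4, 2] \<and>
    avoids_pattern n \<pi> [4, 2, 5, 1, 3] \<and>
    avoids_pattern n \<pi> [3, 5, 1, 6, 2, 4]"
  (is "?R = ?B \<longleftrightarrow> ?avoids")
proof
  assume "?R = ?B"
  then have "?R \<subseteq> ?B" by (rule equalityD1)
  then show ?avoids by (intro conjI rook_perms_subset_imp_avoids[OF assms(2)])
next
  assume avoids: ?avoids
  show "?R = ?B"
  proof (rule subset_antisym)
    show "?R \<subseteq> ?B"
    proof (rule subsetI, rule ccontr)
      fix \<sigma>
      assume "\<sigma> \<in> ?R" "\<sigma> \<notin> ?B"
      from exceeding_rook_perm_imp_pattern[OF assms(2) this] avoids show False by blast
    qed
    show "?B \<subseteq> ?R" by (rule lower_bruhat_interval_subset_rook_perms[OF assms(2)])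
  qed
qed

end
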